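(* For every integer $\gamma\ge0$, the vector space $\mathcal{F}_\gamma$ of $\gamma$-edge valued binary trees, endowed with the operations $\prec_a,\succ_a$ ($a\in[\gamma]$) defined below, is the free $\gamma$-polydendriform algebra over one generator, the generator being the tree with exactly one internal node: $\mathcal{F}_\gamma$ is a $\gamma$-polydendriform algebra, and for every $\gamma$-polydendriform algebra $A$ and every $e\in A$ there is a unique linear map $\mathcal{F}_\gamma\to A$ commuting with all $\prec_a,\succ_a$ and sending the one-node tree to $e$.
   Context: $\mathbb{K}$ is a field of characteristic zero, $[n]=\{1,\dots,n\}$, $a\downarrow a'=\min(a,a')$, extended by $a\downarrow\infty=a=\infty\downarrow a$. A $\gamma$-polydendriform algebra is a $\mathbb{K}$-vector space with bilinear operations $\prec_a,\succ_a$, $a\in[\gamma]$, such that for all $x,y,z$ and $a,a'\in[\gamma]$: $(x\succ_{a'}y)\prec_a z=x\succ_{a'}(y\prec_a z)$; $(x\prec_{a'}y)\prec_a z=x\prec_{a\downarrow a'}(y\prec_a z)+x\prec_{a\downarrow a'}(y\succ_{a'}z)$; $(x\prec_{a'}y)\succ_{a\downarrow a'}z+(x\succ_a y)\succ_{a\downarrow a'}z=x\succ_a(y\succ_{a'}z)$. A $\gamma$-edge valued binary tree is a planar binary tree with at least one internal node (each internal node has a left and a right child, each being a leaf or an internal node) in which every edge joining two internal nodes is labeled by an element of $[\gamma]$; edges joining an internal node to a leaf are regarded as labeled by $\infty$. $\mathcal{F}_\gamma$ is the vector space with basis these trees. Write $\ell$ for the leaf and $N(x,t_1;y,t_2)$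 for the tree whose root has left subtree $t_1$ attached by an edge labeled $x$ and right subtree $t_2$ attached by an edge labeled $y$ ($t_i$ a tree or $\ell$; the label is $\infty$ when $t_i=\ell$), extended linearly in $t_1,t_2$. The operations are defined bilinearly and recursively: for any tree $s$, $s\prec_a\ell:=s$, $\ell\succ_a s:=s$, $\ell\prec_a s:=0$, $s\succ_a\ell:=0$; and for $t=N(x,t_1;y,t_2)$, $t\prec_a s:=N(x,t_1;z,t_2\prec_a s)+N(x,t_1;z,t_2\succ_y s)$ with $z=a\downarrow y$, $s\succ_a t:=N(z,s\succ_a t_1;y,t_2)+N(z,s\prec_x t_1;y,t_2)$ with $z=a\downarrow x$. *)

theory Defs
  imports
    Complex_Main
    "HOL-Library.Poly_Mapping"
    "HOL-Library.Extended_Nat"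
    "HOL-Library.FuncSet"
begin

text \<open>
  The underlying vector space is a linear subspace \<open>A\<close> of an ambient vector space, so that one
  definition covers spaces depending on a natural number. The operations are indexed by all
  natural numbers, but only those with index in \<open>{1..\<gamma>}\<close>, restricted to \<open>A\<close>, are constrained.
\<close>

locale polydendriform_algebra = vector_space scale
  for scale :: "'k::field_char_0 \<Rightarrow> 'a::ab_group_add \<Rightarrow> 'a" +
  fixes \<gamma> :: nat
    and A :: "'a set"
    and lt :: "nat \<Rightarrow> 'a \<Rightarrow> 'a \<Rightarrow> 'a"
    and gt :: "nat \<Rightarrow> 'a \<Rightarrow> 'a \<Rightarrow> 'a"
  assumes subspace_carrier: "subspace A"
    and lt_closed: "\<lbrakk>a \<in> {1..\<gamma>}; x \<in> A; y \<in> A\<rbrakk> \<Longrightarrow> lt a x y \<in> A"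
    and gt_closed: "\<lbrakk>a \<in> {1..\<gamma>}; x \<in> A; y \<in> A\<rbrakk> \<Longrightarrow> gt a x y \<in> A"
    and lt_add_left: "\<lbrakk>a \<in> {1..\<gamma>}; x \<in> A; x' \<in> A; y \<in> A\<rbrakk>
          \<Longrightarrow> lt a (x + x') y = lt a x y + lt a x' y"
    and lt_add_right: "\<lbrakk>a \<in> {1..\<gamma>}; x \<in> A; y \<in> A; y' \<in> A\<rbrakk>
          \<Longrightarrow> lt a x (y + y') = lt a x y + lt a x y'"
    and lt_scale_left: "\<lbrakk>a \<in> {1..\<gamma>}; x \<in> A; y \<in> A\<rbrakk> \<Longrightarrow> lt a (scale c x) y = scale c (lt a x y)"
    and lt_scale_right: "\<lbrakk>a \<in> {1..\<gamma>}; x \<in> A; y \<in> A\<rbrakk> \<Longrightarrow> lt a x (scale c y) = scale c (lt a x y)"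
    and gt_add_left: "\<lbrakk>a \<in> {1..\<gamma>}; x \<in> A; x' \<in> A; y \<in> A\<rbrakk>
          \<Longrightarrow> gt a (x + x') y = gt a x y + gt a x' y"
    and gt_add_right: "\<lbrakk>a \<in> {1..\<gamma>}; x \<in> A; y \<in> A; y' \<in> A\<rbrakk>
          \<Longrightarrow> gt a x (y + y') = gt a x y + gt a x y'"
    and gt_scale_left: "\<lbrakk>a \<in> {1..\<gamma>}; x \<in> A; y \<in> A\<rbrakk> \<Longrightarrow> gt a (scale c x) y = scale c (gt a x y)"
    and gt_scale_right: "\<lbrakk>a \<in> {1..\<gamma>}; x \<in> A; y \<in> A\<rbrakk> \<Longrightarrow> gt a x (scale c y) = scale c (gt a x y)"
    and gt_lt: "\<lbrakk>a \<in> {1..\<gamma>}; a' \<in> {1..\<gamma>}; x \<in> A; y \<in> A; z \<in> A\<rbrakk>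
          \<Longrightarrow> lt a (gt a' x y) z = gt a' x (lt a y z)"
    and lt_lt: "\<lbrakk>a \<in> {1..\<gamma>}; a' \<in> {1..\<gamma>}; x \<in> A; y \<in> A; z \<in> A\<rbrakk>
          \<Longrightarrow> lt a (lt a' x y) z = lt (min a a') x (lt a y z) + lt (min a a') x (gt a' y z)"
    and gt_gt: "\<lbrakk>a \<in> {1..\<gamma>}; a' \<in> {1..\<gamma>}; x \<in> A; y \<in> A; z \<in> A\<rbrakk>
          \<Longrightarrow> gt (min a a') (lt a' x y) z + gt (min a a') (gt a x y) z = gt a x (gt a' y z)"

definition polydendriform_hom ::
  "nat \<Rightarrow> ('k::field_char_0 \<Rightarrow> 'a::ab_group_add \<Rightarrow> 'a) \<Rightarrow> 'a set
    \<Rightarrow> (nat \<Rightarrow> 'a \<Rightarrow> 'a \<Rightarrow> 'a) \<Rightarrow> (nat \<Rightarrow> 'a \<Rightarrow> 'a \<Rightarrow> 'a)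
    \<Rightarrow> ('k \<Rightarrow> 'b::ab_group_add \<Rightarrow> 'b) \<Rightarrow> 'b set
    \<Rightarrow> (nat \<Rightarrow> 'b \<Rightarrow> 'b \<Rightarrow> 'b) \<Rightarrow> (nat \<Rightarrow> 'b \<Rightarrow> 'b \<Rightarrow> 'b)
    \<Rightarrow> ('a \<Rightarrow> 'b) \<Rightarrow> bool"
  where
  "polydendriform_hom \<gamma> scaleA A ltA gtA scaleB B ltB gtB \<phi> \<longleftrightarrow>
     \<phi> \<in> A \<rightarrow> B \<and>
     (\<forall>x\<in>A. \<forall>y\<in>A. \<phi> (x + y) = \<phi> x + \<phi> y) \<and>
     (\<forall>c. \<forall>x\<in>A. \<phi> (scaleA c x) = scaleB c (\<phi> x)) \<and>
     (\<forall>a\<in>{1..\<gamma>}. \<forall>x\<in>A. \<forall>y\<in>A. \<phi> (ltA a x y) = ltB a (\<phi> x) (\<phi> y)) \<and>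
     (\<forall>a\<in>{1..\<gamma>}. \<forall>x\<in>A. \<forall>y\<in>A. \<phi> (gtA a x y) = gtB a (\<phi> x) (\<phi> y))"

text \<open>
  \<open>Node x t1 y t2\<close> is the tree N(x, t1; y, t2). Edge labels live in \<^typ>\<open>enat\<close>, where
  \<^const>\<open>min\<close> is the extended operation on labels; the predicate \<open>valid_tree\<close> singles out the
  correctly labelled trees (and the leaf).
\<close>

datatype etree = Leaf | Node enat etree enat etree

fun valid_edge :: "nat \<Rightarrow> enat \<Rightarrow> etree \<Rightarrow> bool" where
  "valid_edge \<gamma> x Leaf \<longleftrightarrow> x = \<infinity>"
| "valid_edge \<gamma> x (Node _ _ _ _) \<longleftrightarrow> x \<in> enat ` {1..\<gamma>}"

fun valid_tree :: "nat \<Rightarrow> etree \<Rightarrow> bool" where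
  "valid_tree \<gamma> Leaf \<longleftrightarrow> True"
| "valid_tree \<gamma> (Node x t1 y t2) \<longleftrightarrow>
     valid_edge \<gamma> x t1 \<and> valid_tree \<gamma> t1 \<and> valid_edge \<gamma> y t2 \<and> valid_tree \<gamma> t2"

definition edge_valued_trees :: "nat \<Rightarrow> etree set" where
  "edge_valued_trees \<gamma> = {t. t \<noteq> Leaf \<and> valid_tree \<gamma> t}"

definition fscale :: "'k::field \<Rightarrow> ('t \<Rightarrow>\<^sub>0 'k) \<Rightarrow> ('t \<Rightarrow>\<^sub>0 'k)" where
  "fscale c p = Poly_Mapping.map ((*) c) p"

definition lin_ext :: "('s \<Rightarrow> ('t \<Rightarrow>\<^sub>0 'k::field)) \<Rightarrow> ('s \<Rightarrow>\<^sub>0 'k) \<Rightarrow> ('t \<Rightarrow>\<^sub>0 'k)" where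
  "lin_ext f p = (\<Sum>t\<in>Poly_Mapping.keys p. fscale (Poly_Mapping.lookup p t) (f t))"

definition tree_space :: "nat \<Rightarrow> (etree \<Rightarrow>\<^sub>0 'k::field) set" where
  "tree_space \<gamma> = {p. Poly_Mapping.keys p \<subseteq> edge_valued_trees \<gamma>}"

text \<open>
  The operations on basis trees. The index is an \<^typ>\<open>enat\<close> because the recursion passes the
  label of an edge, possibly \<open>\<infinity>\<close>, on as an index. The values on two leaves are irrelevant: they are
  never reached from a pair of arguments of which at least one is not a leaf.
\<close>

function (sequential)
  tree_lt :: "enat \<Rightarrow> etree \<Rightarrow> etree \<Rightarrow> (etree \<Rightarrow>\<^sub>0 'k::field)" and
  tree_gt :: "enat \<Rightarrow> etree \<Rightarrow> etree \<Rightarrow> (etree \<Rightarrow>\<^sub>0 'k::field)"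
where
  "tree_lt a Leaf s = 0"
| "tree_lt a t Leaf = Poly_Mapping.single t 1"
| "tree_lt a (Node x t1 y t2) s =
     lin_ext (\<lambda>u. Poly_Mapping.single (Node x t1 (min a y) u) 1) (tree_lt a t2 s) +
     lin_ext (\<lambda>u. Poly_Mapping.single (Node x t1 (min a y) u) 1) (tree_gt y t2 s)"
| "tree_gt a s Leaf = 0"
| "tree_gt a Leaf t = Poly_Mapping.single t 1"
| "tree_gt a s (Node x t1 y t2) =
     lin_ext (\<lambda>u. Poly_Mapping.single (Node (min a x) u y t2) 1) (tree_gt a s t1) +
     lin_ext (\<lambda>u. Poly_Mapping.single (Node (min a x) u y t2) 1) (tree_lt x s t1)"
  by pat_completeness auto
termination
  by (relation "measure (\<lambda>z. case z of Inl (a, t, s) \<Rightarrow> size t + size s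
                                    | Inr (a, s, t) \<Rightarrow> size s + size t)") auto

definition bilin_ext ::
  "('s \<Rightarrow> 's \<Rightarrow> ('t \<Rightarrow>\<^sub>0 'k::field)) \<Rightarrow> ('s \<Rightarrow>\<^sub>0 'k) \<Rightarrow> ('s \<Rightarrow>\<^sub>0 'k) \<Rightarrow> ('t \<Rightarrow>\<^sub>0 'k)" where
  "bilin_ext f p q = lin_ext (\<lambda>s. lin_ext (\<lambda>t. f s t) q) p"

definition space_lt ::
  "nat \<Rightarrow> (etree \<Rightarrow>\<^sub>0 'k::field) \<Rightarrow> (etree \<Rightarrow>\<^sub>0 'k) \<Rightarrow> (etree \<Rightarrow>\<^sub>0 'k)" where
  "space_lt a = bilin_ext (tree_lt (enat a))"

definition space_gt ::
  "nat \<Rightarrow> (etree \<Rightarrow>\<^sub>0 'k::field) \<Rightarrow> (etree \<Rightarrow>\<^sub>0 'k) \<Rightarrow> (etree \<Rightarrow>\<^sub>0 'k)" where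
  "space_gt a = bilin_ext (tree_gt (enat a))"

definition one_node_tree :: etree where
  "one_node_tree = Node \<infinity> Leaf \<infinity> Leaf"

end

theory Submission
  imports Defs
begin

text \<open>
  All three relations are checked on basis trees. The relation between \<open>\<succ>\<close> and \<open>\<prec>\<close> holds because the
  two operations modify different subtrees of the middle argument. Expanding the other two at the
  root of the left, respectively right, argument reduces both of them to all three relations for a
  subtree of that argument. For freeness, \<open>N(x, t1; y, t2) = (t1 \<succ>\<^sub>x Y) \<prec>\<^sub>y t2\<close> with \<open>Y\<close> the one-node
  tree, so a morphism is determined by the image \<open>e\<close> of \<open>Y\<close>; conversely, reading this formula in an
  algebra \<open>A\<close> defines a linear map, and the relations of \<open>A\<close> turn the recursive definition of the
  operations on trees into the statement that this map is a morphism.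
\<close>

section \<open>Linear extensions\<close>

text \<open>The sum of \<open>lin_ext\<close> with values in an arbitrary space: at
  \<open>fscale\<close> it yields the calculus of \<open>lin_ext\<close>, and at the scaling of an
  algebra it gives the morphism out of the trees.\<close>

definition linear_extension ::
  "('k::field \<Rightarrow> 'a::ab_group_add \<Rightarrow> 'a) \<Rightarrow> ('t \<Rightarrow> 'a) \<Rightarrow> ('t \<Rightarrow>\<^sub>0 'k) \<Rightarrow> 'a" where
  "linear_extension scale f p =
     (\<Sum>t\<in>Poly_Mapping.keys p. scale (Poly_Mapping.lookup p t) (f t))"

lemma lin_ext_eq_linear_extension: "lin_ext = linear_extension fscale"
  by (simp add: fun_eq_iff lin_ext_def linear_extension_def)

lemma lookup_fscale [simp]: "Poly_Mapping.lookup (fscale c p) t = c * Poly_Mapping.lookup p t"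
  by (simp add: fscale_def Poly_Mapping.map.rep_eq when_def)

lemma fscale_single [simp]: "fscale c (Poly_Mapping.single t d) = Poly_Mapping.single t (c * d)"
  by (rule poly_mapping_eqI) (simp add: lookup_single when_def)

lemma keys_fscale: "Poly_Mapping.keys (fscale c p) \<subseteq> Poly_Mapping.keys p"
  by (auto simp: in_keys_iff)

interpretation fscale: vector_space fscale
  by unfold_locales (auto intro!: poly_mapping_eqI simp: lookup_add algebra_simps)

context vector_space
begin

text \<open>Coefficients vanish off the keys, so \<open>p\<close>, \<open>q\<close> and
  \<open>p + q\<close> can be summed over one common index set.\<close>

lemma linear_extension_superset:
  assumes "finite S" "Poly_Mapping.keys p \<subseteq> S"
  shows "linear_extension scale f p = (\<Sum>t\<in>S. scale (Poly_Mapping.lookup p t) (f t))"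
  unfolding linear_extension_def using assms
  by (intro sum.mono_neutral_left) (auto simp: in_keys_iff)

lemma linear_extension_zero [simp]: "linear_extension scale f 0 = 0"
  by (simp add: linear_extension_def)

lemma linear_extension_single [simp]:
  "linear_extension scale f (Poly_Mapping.single t c) = scale c (f t)"
  by (simp add: linear_extension_def)

lemma linear_extension_add:
  "linear_extension scale f (p + q) = linear_extension scale f p + linear_extension scale f q"
proof -
  let ?S = "Poly_Mapping.keys p \<union> Poly_Mapping.keys q"
  have "Poly_Mapping.keys (p + q) \<subseteq> ?S" by (rule keys_add)
  then show ?thesis
    by (simp add: linear_extension_superset[of ?S] lookup_add scale_left_distrib sum.distrib)
qed

lemma linear_extension_fscale:
  "linear_extension scale f (fscale c p) = scale c (linear_extension scale f p)"
  by (simp add: linear_extension_superset[of "Poly_Mapping.keys p"] keys_fscale scale_sum_right)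

lemma linear_extension_fun_zero [simp]: "linear_extension scale (\<lambda>t. 0) p = 0"
  by (simp add: linear_extension_def)

lemma linear_extension_fun_add:
  "linear_extension scale (\<lambda>t. f t + g t) p = linear_extension scale f p + linear_extension scale g p"
  by (simp add: linear_extension_def scale_right_distrib sum.distrib)

lemma linear_extension_fun_scale:
  "linear_extension scale (\<lambda>t. scale c (f t)) p = scale c (linear_extension scale f p)"
  by (simp add: linear_extension_def scale_sum_right mult.commute)

lemma linear_extension_cong:
  assumes "\<And>t. t \<in> Poly_Mapping.keys p \<Longrightarrow> f t = g t"
  shows "linear_extension scale f p = linear_extension scale g p"
  using assms by (simp add: linear_extension_def)

lemma linear_extension_in_subspace:
  assumes "subspace S" "\<And>t. t \<in> Poly_Mapping.keys p \<Longrightarrow> f t \<in> S"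
  shows "linear_extension scale f p \<in> S"
  unfolding linear_extension_def using assms by (auto intro!: subspace_sum subspace_scale)

lemma linear_extension_swap:
  "linear_extension scale (\<lambda>s. linear_extension scale (f s) q) p =
   linear_extension scale (\<lambda>t. linear_extension scale (\<lambda>s. f s t) p) q"
  unfolding linear_extension_def scale_sum_right
  by (subst sum.swap) (simp add: mult.commute)

end

context vector_space_pair
begin

text \<open>Linearity of \<open>h\<close> is assumed on \<open>S\<close> alone, because operations
  and morphisms of algebras are constrained on the carrier only. The induction therefore keeps every
  partial sum inside \<open>S\<close>.\<close>

lemma linear_extension_image:
  assumes S: "vs1.subspace S"
    and add: "\<And>x y. x \<in> S \<Longrightarrow> y \<in> S \<Longrightarrow> h (x + y) = h x + h y"
    and scale: "\<And>c x. x \<in> S \<Longrightarrow> h (s1 c x) = s2 c (h x)"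
    and f: "\<And>t. t \<in> Poly_Mapping.keys p \<Longrightarrow> f t \<in> S"
  shows "h (linear_extension s1 f p) = linear_extension s2 (\<lambda>t. h (f t)) p"
proof -
  have h0: "h 0 = 0"
    using add[of 0 0] vs1.subspace_0[OF S] by simp
  have "h (\<Sum>t\<in>T. s1 (Poly_Mapping.lookup p t) (f t)) =
        (\<Sum>t\<in>T. s2 (Poly_Mapping.lookup p t) (h (f t)))"
    if "finite T" "T \<subseteq> Poly_Mapping.keys p" for T
    using that
  proof induction
    case (insert t T)
    then have "(\<Sum>t\<in>T. s1 (Poly_Mapping.lookup p t) (f t)) \<in> S"
      using f S by (auto intro!: vs1.subspace_sum vs1.subspace_scale)
    with insert show ?case
      using f[of t] by (simp add: add scale vs1.subspace_scale[OF S])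
  qed (simp add: h0)
  then show ?thesis by (simp add: linear_extension_def)
qed

end

lemmas lin_ext_add = fscale.linear_extension_add[folded lin_ext_eq_linear_extension]
lemmas lin_ext_fscale = fscale.linear_extension_fscale[folded lin_ext_eq_linear_extension]
lemmas lin_ext_single [simp] = fscale.linear_extension_single[folded lin_ext_eq_linear_extension]
lemmas lin_ext_zero [simp] = fscale.linear_extension_zero[folded lin_ext_eq_linear_extension]
lemmas lin_ext_fun_zero [simp] = fscale.linear_extension_fun_zero[folded lin_ext_eq_linear_extension]
lemmas lin_ext_fun_add = fscale.linear_extension_fun_add[folded lin_ext_eq_linear_extension]
lemmas lin_ext_fun_scale = fscale.linear_extension_fun_scale[folded lin_ext_eq_linear_extension]
lemmas lin_ext_cong = fscale.linear_extension_cong[folded lin_ext_eq_linear_extension]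
lemmas lin_ext_in_subspace =
  fscale.linear_extension_in_subspace[folded lin_ext_eq_linear_extension]
lemmas lin_ext_swap = fscale.linear_extension_swap[folded lin_ext_eq_linear_extension]

lemma (in vector_space) linear_extension_lin_ext:
  "linear_extension scale f (lin_ext g p) =
   linear_extension scale (\<lambda>t. linear_extension scale f (g t)) p"
proof -
  interpret vector_space_pair fscale scale ..
  show ?thesis
    unfolding lin_ext_eq_linear_extension
    by (rule linear_extension_image[of UNIV])
       (auto simp: linear_extension_add linear_extension_fscale fscale.subspace_UNIV)
qed

lemmas lin_ext_lin_ext = fscale.linear_extension_lin_ext[folded lin_ext_eq_linear_extension]

lemma lin_ext_unit [simp]: "lin_ext (\<lambda>t. Poly_Mapping.single t 1) p = p"
  by (rule poly_mapping_eqI)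
     (auto simp: lin_ext_def lookup_sum lookup_single when_def in_keys_iff sum.delta')

lemma subspace_keys_subset: "fscale.subspace {p. Poly_Mapping.keys p \<subseteq> T}"
  unfolding fscale.subspace_def using keys_add keys_fscale by fastforce

lemma keys_lin_ext:
  "(\<And>t. t \<in> Poly_Mapping.keys p \<Longrightarrow> Poly_Mapping.keys (f t) \<subseteq> T) \<Longrightarrow>
   Poly_Mapping.keys (lin_ext f p) \<subseteq> T"
  using lin_ext_in_subspace[OF subspace_keys_subset[of T], of p f] by auto

text \<open>With the next lemma, both bracketings of a triple product become sums over triples of
  basis trees in the same order, so a trilinear identity follows triple by triple from
  \<open>lin_ext_cong\<close>.\<close>

lemma bilin_ext_bilin_ext_left:
  "bilin_ext f (bilin_ext g p q) r =
   lin_ext (\<lambda>s. lin_ext (\<lambda>t. lin_ext (\<lambda>u. lin_ext (\<lambda>v. f v u) (g s t)) r) q) p"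
  unfolding bilin_ext_def lin_ext_lin_ext by (subst lin_ext_swap) (rule refl)

lemma bilin_ext_bilin_ext_right:
  "bilin_ext f p (bilin_ext g q r) =
   lin_ext (\<lambda>s. lin_ext (\<lambda>t. lin_ext (\<lambda>u. lin_ext (f s) (g t u)) r) q) p"
  unfolding bilin_ext_def lin_ext_lin_ext ..

lemma bilin_ext_add_left: "bilin_ext f (p + p') q = bilin_ext f p q + bilin_ext f p' q"
  by (simp add: bilin_ext_def lin_ext_add)

lemma bilin_ext_add_right: "bilin_ext f p (q + q') = bilin_ext f p q + bilin_ext f p q'"
  by (simp add: bilin_ext_def lin_ext_add lin_ext_fun_add)

lemma bilin_ext_scale_left: "bilin_ext f (fscale c p) q = fscale c (bilin_ext f p q)"
  by (simp add: bilin_ext_def lin_ext_fscale)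

lemma bilin_ext_scale_right: "bilin_ext f p (fscale c q) = fscale c (bilin_ext f p q)"
  by (simp add: bilin_ext_def lin_ext_fscale lin_ext_fun_scale)

lemma bilin_ext_single [simp]:
  "bilin_ext f (Poly_Mapping.single s 1) (Poly_Mapping.single t 1) = f s t"
  by (simp add: bilin_ext_def)

section \<open>The relations on trees\<close>

abbreviation node_left :: "enat \<Rightarrow> enat \<Rightarrow> etree \<Rightarrow> (etree \<Rightarrow>\<^sub>0 'k::field) \<Rightarrow> (etree \<Rightarrow>\<^sub>0 'k)" where
  "node_left x y t2 \<equiv> lin_ext (\<lambda>u. Poly_Mapping.single (Node x u y t2) 1)"

abbreviation node_right :: "enat \<Rightarrow> etree \<Rightarrow> enat \<Rightarrow> (etree \<Rightarrow>\<^sub>0 'k::field) \<Rightarrow> (etree \<Rightarrow>\<^sub>0 'k)" where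
  "node_right x t1 y \<equiv> lin_ext (\<lambda>u. Poly_Mapping.single (Node x t1 y u) 1)"

text \<open>An equation of functions, so that it also rewrites the partial application in
  \<open>lin_ext (tree_lt a Leaf) p\<close>.\<close>

lemma tree_lt_Leaf_left [simp]: "tree_lt a Leaf = (\<lambda>s. 0)"
  by (simp add: fun_eq_iff)

lemma tree_gt_Leaf_right [simp]: "tree_gt a s Leaf = 0"
  by (cases s) auto

lemma tree_lt_Leaf_right [simp]: "t \<noteq> Leaf \<Longrightarrow> tree_lt a t Leaf = Poly_Mapping.single t 1"
  by (cases t) auto

lemma tree_gt_Leaf_left [simp]: "t \<noteq> Leaf \<Longrightarrow> tree_gt a Leaf t = Poly_Mapping.single t 1"
  by (cases t) auto

lemma tree_lt_Node:
  "s \<noteq> Leaf \<Longrightarrow> tree_lt a (Node x t1 y t2) s =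
     node_right x t1 (min a y) (tree_lt a t2 s + tree_gt y t2 s)"
  by (cases s) (auto simp: lin_ext_add)

lemma tree_gt_Node:
  "s \<noteq> Leaf \<Longrightarrow> tree_gt a s (Node x t1 y t2) =
     node_left (min a x) y t2 (tree_gt a s t1 + tree_lt x s t1)"
  by (cases s) (auto simp: lin_ext_add)

text \<open>The rules by which a leaf returns the other argument unchanged require that argument not
  to be a leaf. Hence products must be known to avoid the leaf before they enter another
  product.\<close>

lemma Leaf_notin_keys_node [simp]:
  "Leaf \<notin> Poly_Mapping.keys (node_left x y t2 p)" "Leaf \<notin> Poly_Mapping.keys (node_right x t1 y p)"
  using keys_lin_ext[of p _ "- {Leaf}"] by fastforce+

lemma Leaf_notin_keys_tree_lt [simp]: "Leaf \<notin> Poly_Mapping.keys (tree_lt a s t)"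
  by (cases s; cases "t = Leaf") (auto simp: tree_lt_Node)

lemma Leaf_notin_keys_tree_gt [simp]: "Leaf \<notin> Poly_Mapping.keys (tree_gt a s t)"
  by (cases t; cases "s = Leaf") (auto simp: tree_gt_Node)

lemma Leaf_notin_keys_add [simp]:
  "Leaf \<notin> Poly_Mapping.keys p \<Longrightarrow> Leaf \<notin> Poly_Mapping.keys q \<Longrightarrow> Leaf \<notin> Poly_Mapping.keys (p + q)"
  using keys_add[of p q] by auto

lemma lin_ext_tree_lt_Leaf:
  "Leaf \<notin> Poly_Mapping.keys p \<Longrightarrow> lin_ext (\<lambda>v. tree_lt a v Leaf) p = p"
  by (subst (3) lin_ext_unit[symmetric], rule lin_ext_cong) (auto intro: tree_lt_Leaf_right)

lemma lin_ext_tree_gt_Leaf: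
  "Leaf \<notin> Poly_Mapping.keys p \<Longrightarrow> lin_ext (tree_gt a Leaf) p = p"
  by (subst (3) lin_ext_unit[symmetric], rule lin_ext_cong) (auto intro: tree_gt_Leaf_left)

text \<open>The first of four expansions of an operation on combinations grafted below a fixed root.
  Either the operation acts on the grafted part, or it acts on the opposite subtree and the grafted
  part \<open>p\<close> is carried along.\<close>

lemma tree_lt_node_right:
  "s \<noteq> Leaf \<Longrightarrow> lin_ext (\<lambda>v. tree_lt a v s) (node_right x t1 y p) =
     node_right x t1 (min a y) (lin_ext (\<lambda>v. tree_lt a v s) p + lin_ext (\<lambda>v. tree_gt y v s) p)"
  by (simp add: lin_ext_lin_ext tree_lt_Node flip: lin_ext_fun_add)

lemma tree_lt_node_left:
  "s \<noteq> Leaf \<Longrightarrow> lin_ext (\<lambda>v. tree_lt a v s) (node_left x y t2 p) =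
     lin_ext (\<lambda>u. node_right x u (min a y) (tree_lt a t2 s + tree_gt y t2 s)) p"
  by (simp add: lin_ext_lin_ext tree_lt_Node)

lemma tree_gt_node_left:
  "s \<noteq> Leaf \<Longrightarrow> lin_ext (tree_gt a s) (node_left x y t2 p) =
     node_left (min a x) y t2 (lin_ext (tree_gt a s) p + lin_ext (tree_lt x s) p)"
  by (simp add: lin_ext_lin_ext tree_gt_Node flip: lin_ext_fun_add)

lemma tree_gt_node_right:
  "s \<noteq> Leaf \<Longrightarrow> lin_ext (tree_gt a s) (node_right x t1 y p) =
     lin_ext (\<lambda>u. node_left (min a x) y u (tree_gt a s t1 + tree_lt x s t1)) p"
  by (simp add: lin_ext_lin_ext tree_gt_Node)

lemma lin_ext_tree_lt_Node:
  assumes "Leaf \<notin> Poly_Mapping.keys p"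
  shows "lin_ext (tree_lt a (Node x t1 y t2)) p =
     node_right x t1 (min a y) (lin_ext (tree_lt a t2) p + lin_ext (tree_gt y t2) p)"
proof -
  have "lin_ext (tree_lt a (Node x t1 y t2)) p =
        lin_ext (\<lambda>s. node_right x t1 (min a y) (tree_lt a t2 s + tree_gt y t2 s)) p"
    using assms by (intro lin_ext_cong tree_lt_Node) auto
  then show ?thesis by (simp add: lin_ext_lin_ext flip: lin_ext_fun_add)
qed

lemma lin_ext_tree_gt_Node:
  assumes "Leaf \<notin> Poly_Mapping.keys p"
  shows "lin_ext (\<lambda>s. tree_gt a s (Node x t1 y t2)) p =
     node_left (min a x) y t2
       (lin_ext (\<lambda>s. tree_gt a s t1) p + lin_ext (\<lambda>s. tree_lt x s t1) p)"
proof -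
  have "lin_ext (\<lambda>s. tree_gt a s (Node x t1 y t2)) p =
        lin_ext (\<lambda>s. node_left (min a x) y t2 (tree_gt a s t1 + tree_lt x s t1)) p"
    using assms by (intro lin_ext_cong tree_gt_Node) auto
  then show ?thesis by (simp add: lin_ext_lin_ext flip: lin_ext_fun_add)
qed

lemma tree_gt_tree_lt:
  assumes "y \<noteq> Leaf"
  shows "lin_ext (\<lambda>v. tree_lt a v z) (tree_gt a' x y) = lin_ext (tree_gt a' x) (tree_lt a y z)"
proof (cases "x = Leaf \<or> z = Leaf")
  case True
  then show ?thesis
    using assms
    by (metis Leaf_notin_keys_tree_lt Leaf_notin_keys_tree_gt lin_ext_tree_lt_Leaf
        lin_ext_tree_gt_Leaf tree_gt_Leaf_left tree_lt_Leaf_right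
        lin_ext_single fscale.scale_one)
next
  case False
  then show ?thesis
    using assms
    \<comment> \<open>Both sides graft the changed left and right subtrees of \<open>y\<close> below
      its root, in opposite nesting. The instance of \<open>lin_ext_swap\<close> fixes the inner
      argument, so it reorders one side only and rewriting terminates.\<close>
    by (cases y) (simp_all add: tree_lt_Node tree_gt_Node tree_gt_node_right tree_lt_node_left
        lin_ext_swap[of _ "tree_gt a' x _ + _"])
qed

text \<open>The part of validity that the induction below relies on; it does not mention \<gamma>
  and passes to subtrees.\<close>

fun leaf_edges_infinite :: "etree \<Rightarrow> bool" where
  "leaf_edges_infinite Leaf \<longleftrightarrow> True"
| "leaf_edges_infinite (Node x t1 y t2) \<longleftrightarrow>
     (t1 = Leaf \<longrightarrow> x = \<infinity>) \<and> leaf_edges_infinite t1 \<and>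
     (t2 = Leaf \<longrightarrow> y = \<infinity>) \<and> leaf_edges_infinite t2"

lemma valid_tree_leaf_edges_infinite: "valid_tree \<gamma> t \<Longrightarrow> leaf_edges_infinite t"
  by (induction t) auto

text \<open>
  The two relations are proved by a simultaneous induction, which descends to subtrees of the outer
  arguments. Hence these may be leaves, and then the relation only holds for the index \<open>\<infinity>\<close>.
\<close>

lemma tree_lt_lt_and_gt_gt:
  fixes x y z :: etree
  assumes y: "y \<noteq> Leaf" and "leaf_edges_infinite x" "leaf_edges_infinite z"
  shows "((z = Leaf \<longrightarrow> a = \<infinity>) \<longrightarrow>
           lin_ext (\<lambda>v. tree_lt a v z) (tree_lt a' x y) =
           lin_ext (tree_lt (min a a') x) (tree_lt a y z + tree_gt a' y z :: etree \<Rightarrow>\<^sub>0 'k::field)) \<and>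
         ((x = Leaf \<longrightarrow> a = \<infinity>) \<longrightarrow>
           lin_ext (\<lambda>v. tree_gt (min a a') v z) (tree_lt a' x y + tree_gt a x y) =
           lin_ext (tree_gt a x) (tree_gt a' y z :: etree \<Rightarrow>\<^sub>0 'k))"
  using assms(2,3)
proof (induction "size x + size z" arbitrary: x z a a' rule: less_induct)
  case less
  note x = less.prems(1) and z = less.prems(2)
  \<comment> \<open>The induction hypotheses with the sums distributed. The middle argument
    \<open>y\<close> stays fixed.\<close>
  have lt_lt: "lin_ext (\<lambda>v. tree_lt b v z') (tree_lt b' x' y) =
      lin_ext (tree_lt (min b b') x') (tree_lt b y z') +
      lin_ext (tree_lt (min b b') x') (tree_gt b' y z' :: etree \<Rightarrow>\<^sub>0 'k)"
    if "size x' + size z' < size x + size z" "leaf_edges_infinite x'" "leaf_edges_infinite z'"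
      "z' = Leaf \<longrightarrow> b = \<infinity>" for x' z' b b'
    using less.hyps[of x' z' b b'] that by (simp add: lin_ext_add)
  have gt_gt: "lin_ext (tree_gt b x') (tree_gt b' y z' :: etree \<Rightarrow>\<^sub>0 'k) =
      lin_ext (\<lambda>v. tree_gt (min b b') v z') (tree_lt b' x' y) +
      lin_ext (\<lambda>v. tree_gt (min b b') v z') (tree_gt b x' y)"
    if "size x' + size z' < size x + size z" "leaf_edges_infinite x'" "leaf_edges_infinite z'"
      "x' = Leaf \<longrightarrow> b = \<infinity>" for x' z' b b'
    using less.hyps[of x' z' b b'] that by (simp add: lin_ext_add)
  show ?case
  proof (intro conjI impI)
    assume a: "z = Leaf \<longrightarrow> a = \<infinity>"
    show "lin_ext (\<lambda>v. tree_lt a v z) (tree_lt a' x y) =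
          lin_ext (tree_lt (min a a') x) (tree_lt a y z + tree_gt a' y z :: etree \<Rightarrow>\<^sub>0 'k)"
    proof (cases x)
      case (Node p x1 q x2)
      show ?thesis
      proof (cases "z = Leaf")
        \<comment> \<open>Here \<open>a = \<infinity>\<close>, so \<open>min a a' = a'\<close> and
          both sides equal \<open>tree_lt a' x y\<close>.\<close>
        case True
        with a y Node show ?thesis by (simp add: lin_ext_tree_lt_Leaf)
      next
        case False
        \<comment> \<open>The content below the common root of both sides. The first summand is the
          \<open>\<prec>\<prec>\<close> relation for \<open>x2\<close>, the second the mixed
          relation, and the last two together the \<open>\<succ>\<succ>\<close> relation for
          \<open>x2\<close> with index \<open>q\<close>, which is \<infinity> if \<open>x2\<close>
          is a leaf.\<close>
        have "lin_ext (\<lambda>v. tree_lt a v z) (tree_lt a' x2 y)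
            + lin_ext (\<lambda>v. tree_lt a v z) (tree_gt q x2 y)
            + (lin_ext (\<lambda>v. tree_gt (min a' q) v z) (tree_lt a' x2 y)
            + lin_ext (\<lambda>v. tree_gt (min a' q) v z) (tree_gt q x2 y)) =
          lin_ext (tree_lt (min a a') x2) (tree_lt a y z)
            + lin_ext (tree_lt (min a a') x2) (tree_gt a' y z)
            + (lin_ext (tree_gt q x2) (tree_lt a y z)
            + lin_ext (tree_gt q x2) (tree_gt a' y z :: etree \<Rightarrow>\<^sub>0 'k))"
          using x z a Node lt_lt[of x2 z a a'] gt_gt[of x2 z q a']
            tree_gt_tree_lt[OF y, of a z q x2, where ?'a='k]
          by (simp add: min.commute)
        from arg_cong[OF this, of "node_right p x1 (min a (min a' q))"] False y Node show ?thesis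
          by (simp add: tree_lt_Node tree_lt_node_right lin_ext_tree_lt_Node lin_ext_add min.assoc
              add_ac)
      qed
    qed simp
  next
    assume a: "x = Leaf \<longrightarrow> a = \<infinity>"
    show "lin_ext (\<lambda>v. tree_gt (min a a') v z) (tree_lt a' x y + tree_gt a x y) =
          lin_ext (tree_gt a x) (tree_gt a' y z :: etree \<Rightarrow>\<^sub>0 'k)"
    proof (cases z)
      case (Node p z1 q z2)
      show ?thesis
      proof (cases "x = Leaf")
        case True
        with a y Node show ?thesis by (simp add: lin_ext_tree_gt_Leaf)
      next
        case False
        \<comment> \<open>The mirror image: the first two summands form the
          \<open>\<succ>\<succ>\<close> relation for \<open>z1\<close>, the third is the
          \<open>\<prec>\<prec>\<close> relation with index \<open>p\<close>, which is \<infinity>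
          if \<open>z1\<close> is a leaf, and the fourth the mixed relation.\<close>
        have "lin_ext (\<lambda>v. tree_gt (min a a') v z1) (tree_lt a' x y)
            + lin_ext (\<lambda>v. tree_gt (min a a') v z1) (tree_gt a x y)
            + (lin_ext (\<lambda>v. tree_lt p v z1) (tree_lt a' x y)
            + lin_ext (\<lambda>v. tree_lt p v z1) (tree_gt a x y)) =
          lin_ext (tree_gt a x) (tree_gt a' y z1) + lin_ext (tree_gt a x) (tree_lt p y z1)
            + (lin_ext (tree_lt (min a' p) x) (tree_gt a' y z1)
            + lin_ext (tree_lt (min a' p) x) (tree_lt p y z1 :: etree \<Rightarrow>\<^sub>0 'k))"
          using x z a Node lt_lt[of x z1 p a'] gt_gt[of x z1 a a']
            tree_gt_tree_lt[OF y, of p z1 a x, where ?'a='k]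
          by (simp add: min.commute)
        from arg_cong[OF this, of "node_left (min a (min a' p)) q z2"] False y Node show ?thesis
          by (simp add: tree_gt_Node tree_gt_node_left lin_ext_tree_gt_Node lin_ext_add min.assoc
              add_ac)
      qed
    qed simp
  qed
qed

section \<open>Closure of the valid trees under the operations\<close>

lemma valid_edge_not_Leaf: "t \<noteq> Leaf \<Longrightarrow> valid_edge \<gamma> x t \<longleftrightarrow> x \<in> enat ` {1..\<gamma>}"
  by (cases t) auto

lemma valid_edge_cases: "valid_edge \<gamma> x t \<Longrightarrow> x \<in> enat ` {1..\<gamma>} \<or> x = \<infinity> \<and> t = Leaf"
  by (cases t) auto

text \<open>When a leaf is replaced by a tree, its label \<infinity> is neutral for
  \<open>min\<close>, so the new inner edge gets the index \<open>a\<close> itself.\<close>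

lemma min_valid_edge: "a \<in> enat ` {1..\<gamma>} \<Longrightarrow> valid_edge \<gamma> x t \<Longrightarrow> min a x \<in> enat ` {1..\<gamma>}"
  by (auto simp: min_def dest: valid_edge_cases)

text \<open>The recursion passes on an edge label as index. That label is \<infinity> only above a
  leaf, and this leaf is then the argument named in the disjunction, for which the result does not
  depend on the index.\<close>

lemma keys_tree_lt_tree_gt:
  assumes "valid_tree \<gamma> s" "valid_tree \<gamma> t"
  shows "(a \<in> enat ` {1..\<gamma>} \<or> t = Leaf \<longrightarrow>
           Poly_Mapping.keys (tree_lt a s t :: etree \<Rightarrow>\<^sub>0 'k::field) \<subseteq> edge_valued_trees \<gamma>) \<and>
         (a \<in> enat ` {1..\<gamma>} \<or> s = Leaf \<longrightarrow>
           Poly_Mapping.keys (tree_gt a s t :: etree \<Rightarrow>\<^sub>0 'k) \<subseteq> edge_valued_trees \<gamma>)"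
  using assms
proof (induction "size s + size t" arbitrary: s t a rule: less_induct)
  case less
  note s = less.prems(1) and t = less.prems(2)
  show ?case
  proof (intro conjI impI)
    assume a: "a \<in> enat ` {1..\<gamma>} \<or> t = Leaf"
    show "Poly_Mapping.keys (tree_lt a s t :: etree \<Rightarrow>\<^sub>0 'k) \<subseteq> edge_valued_trees \<gamma>"
    proof (cases "s = Leaf \<or> t = Leaf")
      case True
      with s show ?thesis by (cases "s = Leaf") (auto simp: edge_valued_trees_def)
    next
      case False
      then obtain x s1 y s2 where Node: "s = Node x s1 y s2" by (cases s) auto
      have "Poly_Mapping.keys (tree_lt a s2 t + tree_gt y s2 t :: etree \<Rightarrow>\<^sub>0 'k) \<subseteq> edge_valued_trees \<gamma>"
        using less.hyps[of s2 t a] less.hyps[of s2 t y] s t a False valid_edge_cases[of \<gamma> y s2]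
          keys_add[of "tree_lt a s2 t :: etree \<Rightarrow>\<^sub>0 'k" "tree_gt y s2 t"] unfolding Node by fastforce
      then show ?thesis
        using False a s min_valid_edge[of a \<gamma> y s2] unfolding Node
        by (simp add: tree_lt_Node)
           (rule keys_lin_ext, auto simp: edge_valued_trees_def valid_edge_not_Leaf)
    qed
  next
    assume a: "a \<in> enat ` {1..\<gamma>} \<or> s = Leaf"
    show "Poly_Mapping.keys (tree_gt a s t :: etree \<Rightarrow>\<^sub>0 'k) \<subseteq> edge_valued_trees \<gamma>"
    proof (cases "s = Leaf \<or> t = Leaf")
      case True
      with t show ?thesis by (cases "t = Leaf") (auto simp: edge_valued_trees_def)
    next
      case False
      then obtain x t1 y t2 where Node: "t = Node x t1 y t2" by (cases t) auto
      have "Poly_Mapping.keys (tree_gt a s t1 + tree_lt x s t1 :: etree \<Rightarrow>\<^sub>0 'k) \<subseteq> edge_valued_trees \<gamma>"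
        using less.hyps[of s t1 a] less.hyps[of s t1 x] s t a False valid_edge_cases[of \<gamma> x t1]
          keys_add[of "tree_gt a s t1 :: etree \<Rightarrow>\<^sub>0 'k" "tree_lt x s t1"] unfolding Node by fastforce
      then show ?thesis
        using False a t min_valid_edge[of a \<gamma> x t1] unfolding Node
        by (simp add: tree_gt_Node)
           (rule keys_lin_ext, auto simp: edge_valued_trees_def valid_edge_not_Leaf)
    qed
  qed
qed

lemma keys_tree_lt:
  "valid_tree \<gamma> s \<Longrightarrow> valid_tree \<gamma> t \<Longrightarrow> a \<in> {1..\<gamma>} \<Longrightarrow>
   Poly_Mapping.keys (tree_lt (enat a) s t) \<subseteq> edge_valued_trees \<gamma>"
  using keys_tree_lt_tree_gt[of \<gamma> s t "enat a"] by blast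

lemma keys_tree_gt:
  "valid_tree \<gamma> s \<Longrightarrow> valid_tree \<gamma> t \<Longrightarrow> a \<in> {1..\<gamma>} \<Longrightarrow>
   Poly_Mapping.keys (tree_gt (enat a) s t) \<subseteq> edge_valued_trees \<gamma>"
  using keys_tree_lt_tree_gt[of \<gamma> s t "enat a"] by blast

section \<open>The free algebra\<close>

lemma tree_space_polydendriform:
  "polydendriform_algebra (fscale :: 'k::field_char_0 \<Rightarrow> (etree \<Rightarrow>\<^sub>0 'k) \<Rightarrow> _)
     \<gamma> (tree_space \<gamma>) space_lt space_gt"
proof
  fix a a' :: nat and x y z x' y' :: "etree \<Rightarrow>\<^sub>0 'k" and c :: 'k
  show "fscale.subspace (tree_space \<gamma> :: (etree \<Rightarrow>\<^sub>0 'k) set)"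
    unfolding tree_space_def by (rule subspace_keys_subset)
  show "space_lt a (x + x') y = space_lt a x y + space_lt a x' y"
    "space_lt a x (y + y') = space_lt a x y + space_lt a x y'"
    "space_gt a (x + x') y = space_gt a x y + space_gt a x' y"
    "space_gt a x (y + y') = space_gt a x y + space_gt a x y'"
    "space_lt a (fscale c x) y = fscale c (space_lt a x y)"
    "space_lt a x (fscale c y) = fscale c (space_lt a x y)"
    "space_gt a (fscale c x) y = fscale c (space_gt a x y)"
    "space_gt a x (fscale c y) = fscale c (space_gt a x y)"
    by (simp_all add: space_lt_def space_gt_def bilin_ext_add_left bilin_ext_add_right
        bilin_ext_scale_left bilin_ext_scale_right)
  assume a: "a \<in> {1..\<gamma>}" and x: "x \<in> tree_space \<gamma>" and y: "y \<in> tree_space \<gamma>"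
  show "space_lt a x y \<in> tree_space \<gamma>" "space_gt a x y \<in> tree_space \<gamma>"
    unfolding tree_space_def space_lt_def space_gt_def bilin_ext_def
    by (intro CollectI keys_lin_ext keys_tree_lt keys_tree_gt a;
        use x y in \<open>auto simp: tree_space_def edge_valued_trees_def\<close>)+
  assume a': "a' \<in> {1..\<gamma>}" and z: "z \<in> tree_space \<gamma>"
  have min: "enat (min a a') = min (enat a) (enat a')" by (simp add: min_def)
  have basis: "t \<noteq> Leaf" "leaf_edges_infinite t"
    if "t \<in> Poly_Mapping.keys p" "p \<in> tree_space \<gamma>" for t and p :: "etree \<Rightarrow>\<^sub>0 'k"
    using that by (auto simp: tree_space_def edge_valued_trees_def valid_tree_leaf_edges_infinite)
  show "space_lt a (space_gt a' x y) z = space_gt a' x (space_lt a y z)"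
    unfolding space_lt_def space_gt_def bilin_ext_bilin_ext_left bilin_ext_bilin_ext_right
    by (intro lin_ext_cong tree_gt_tree_lt basis[OF _ y])
  \<comment> \<open>The two summands on one side are merged into a single triple sum, so that the
    tree relation applies to each triple of basis trees.\<close>
  show "space_lt a (space_lt a' x y) z =
        space_lt (min a a') x (space_lt a y z) + space_lt (min a a') x (space_gt a' y z)"
    unfolding space_lt_def space_gt_def bilin_ext_bilin_ext_left bilin_ext_bilin_ext_right min
      lin_ext_fun_add[symmetric] lin_ext_add[symmetric]
    by (intro lin_ext_cong tree_lt_lt_and_gt_gt[THEN conjunct1, rule_format])
       (use basis x y z in auto)
  show "space_gt (min a a') (space_lt a' x y) z + space_gt (min a a') (space_gt a x y) z =
        space_gt a x (space_gt a' y z)"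
    unfolding space_lt_def space_gt_def bilin_ext_bilin_ext_left bilin_ext_bilin_ext_right min
      lin_ext_fun_add[symmetric] lin_ext_add[symmetric]
    by (intro lin_ext_cong tree_lt_lt_and_gt_gt[THEN conjunct2, rule_format])
       (use basis x y z in auto)
qed

text \<open>With the next lemma, this builds any tree from the one-node tree: \<infinity> is neutral
  for \<open>min\<close>, so the new label is exactly the index, and of the two summands only the
  one returning the grafted tree survives.\<close>

lemma single_Node_left:
  "t1 \<noteq> Leaf \<Longrightarrow> tree_gt x t1 one_node_tree = Poly_Mapping.single (Node x t1 \<infinity> Leaf) 1"
  by (simp add: one_node_tree_def tree_gt_Node)

lemma single_Node_right:
  "t2 \<noteq> Leaf \<Longrightarrow> tree_lt y (Node x t1 \<infinity> Leaf) t2 = Poly_Mapping.single (Node x t1 y t2) 1"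
  by (simp add: tree_lt_Node)

lemma single_in_tree_space: "t \<in> edge_valued_trees \<gamma> \<Longrightarrow> Poly_Mapping.single t 1 \<in> tree_space \<gamma>"
  by (simp add: tree_space_def)

section \<open>Evaluation of trees in an algebra\<close>

context polydendriform_algebra
begin

lemma linear_extension_image_carrier:
  assumes "\<And>x y. x \<in> A \<Longrightarrow> y \<in> A \<Longrightarrow> h (x + y) = h x + h y"
    and "\<And>c x. x \<in> A \<Longrightarrow> h (scale c x) = scale c (h x)"
    and "\<And>t. t \<in> Poly_Mapping.keys p \<Longrightarrow> f t \<in> A"
  shows "linear_extension scale (\<lambda>t. h (f t)) p = h (linear_extension scale f p)"
proof -
  interpret vector_space_pair scale scale ..
  show ?thesis
    using linear_extension_image[OF subspace_carrier, of h p f] assms by simp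
qed

text \<open>Reduces multiplicativity of an evaluation to pairs of basis elements; \<open>m\<close>
  will be \<open>lt a\<close> and \<open>gt a\<close>, which are bilinear on the carrier.\<close>

lemma linear_extension_bilinear:
  assumes closed: "\<And>x y. x \<in> A \<Longrightarrow> y \<in> A \<Longrightarrow> m x y \<in> A"
    and add_left: "\<And>x x' y. x \<in> A \<Longrightarrow> x' \<in> A \<Longrightarrow> y \<in> A \<Longrightarrow> m (x + x') y = m x y + m x' y"
    and add_right: "\<And>x y y'. x \<in> A \<Longrightarrow> y \<in> A \<Longrightarrow> y' \<in> A \<Longrightarrow> m x (y + y') = m x y + m x y'"
    and scale_left: "\<And>c x y. x \<in> A \<Longrightarrow> y \<in> A \<Longrightarrow> m (scale c x) y = scale c (m x y)"
    and scale_right: "\<And>c x y. x \<in> A \<Longrightarrow> y \<in> A \<Longrightarrow> m x (scale c y) = scale c (m x y)"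
    and p: "\<And>t. t \<in> Poly_Mapping.keys p \<Longrightarrow> f t \<in> A"
    and q: "\<And>t. t \<in> Poly_Mapping.keys q \<Longrightarrow> f t \<in> A"
    and g: "\<And>s t. s \<in> Poly_Mapping.keys p \<Longrightarrow> t \<in> Poly_Mapping.keys q \<Longrightarrow>
              linear_extension scale f (g s t) = m (f s) (f t)"
  shows "linear_extension scale f (bilin_ext g p q) =
         m (linear_extension scale f p) (linear_extension scale f q)"
proof -
  have fq: "linear_extension scale f q \<in> A"
    by (rule linear_extension_in_subspace[OF subspace_carrier q])
  have "linear_extension scale f (bilin_ext g p q) =
        linear_extension scale (\<lambda>s. linear_extension scale (\<lambda>t. linear_extension scale f (g s t)) q) p"
    by (simp add: bilin_ext_def linear_extension_lin_ext)
  also have "\<dots> = linear_extension scale (\<lambda>s. linear_extension scale (\<lambda>t. m (f s) (f t)) q) p"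
    by (intro linear_extension_cong g)
  also have "\<dots> = linear_extension scale (\<lambda>s. m (f s) (linear_extension scale f q)) p"
    by (intro linear_extension_cong linear_extension_image_carrier) (auto simp: add_right scale_right p q)
  also have "\<dots> = m (linear_extension scale f p) (linear_extension scale f q)"
    by (rule linear_extension_image_carrier[of "\<lambda>v. m v (linear_extension scale f q)"])
       (auto simp: add_left scale_left fq p)
  finally show ?thesis .
qed

text \<open>The value at \<open>Leaf\<close> is a dummy: an algebra has no unit, so leaf children
  are treated by cases. In valid trees \<open>the_enat\<close> is applied to finite labels
  only.\<close>

primrec eval_tree :: "'a \<Rightarrow> etree \<Rightarrow> 'a" where
  "eval_tree e Leaf = 0"
| "eval_tree e (Node x t1 y t2) =
     (let u = if t1 = Leaf then e else gt (the_enat x) (eval_tree e t1) e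
      in if t2 = Leaf then u else lt (the_enat y) u (eval_tree e t2))"

lemma eval_tree_one_node: "eval_tree e one_node_tree = e"
  by (simp add: one_node_tree_def)

lemma eval_tree_in_carrier:
  assumes "e \<in> A" "valid_tree \<gamma> t"
  shows "eval_tree e t \<in> A"
  using assms(2)
proof (induction t)
  case Leaf
  then show ?case by (simp add: subspace_0 subspace_carrier)
next
  case (Node x t1 y t2)
  then show ?case
    using \<open>e \<in> A\<close> by (auto simp: Let_def valid_edge_not_Leaf intro!: gt_closed lt_closed)
qed

lemma linear_extension_eval_tree_in_carrier:
  assumes "e \<in> A" "p \<in> tree_space \<gamma>"
  shows "linear_extension scale (eval_tree e) p \<in> A"
  using assms
  by (intro linear_extension_in_subspace[OF subspace_carrier] eval_tree_in_carrier)
     (auto simp: tree_space_def edge_valued_trees_def)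

text \<open>No tree in \<open>p\<close> is a leaf, so each takes the \<open>lt\<close> branch with
  the same left factor, the value of the tree with its right subtree cut off. Linearity of
  \<open>lt\<close> on the right does the rest.\<close>

lemma eval_node_right:
  assumes e: "e \<in> A" and t1: "valid_edge \<gamma> x t1" "valid_tree \<gamma> t1" and z: "z \<in> {1..\<gamma>}"
    and p: "Poly_Mapping.keys p \<subseteq> edge_valued_trees \<gamma>"
  shows "linear_extension scale (eval_tree e) (node_right x t1 (enat z) p) =
         lt z (eval_tree e (Node x t1 \<infinity> Leaf)) (linear_extension scale (eval_tree e) p)"
proof -
  let ?w = "eval_tree e (Node x t1 \<infinity> Leaf)"
  have w: "?w \<in> A"
    by (rule eval_tree_in_carrier[OF e]) (use t1 in simp)
  have "linear_extension scale (eval_tree e) (node_right x t1 (enat z) p) =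
        linear_extension scale (\<lambda>u. lt z ?w (eval_tree e u)) p"
    unfolding linear_extension_lin_ext
    by (rule linear_extension_cong) (use p in \<open>auto simp: edge_valued_trees_def Let_def\<close>)
  also have "\<dots> = lt z ?w (linear_extension scale (eval_tree e) p)"
    by (rule linear_extension_image_carrier)
       (use p z w e in \<open>auto simp: lt_add_right lt_scale_right edge_valued_trees_def
          simp del: eval_tree.simps intro!: eval_tree_in_carrier\<close>)
  finally show ?thesis .
qed

text \<open>The left subtree sits innermost in \<open>eval_tree\<close>, so the sum moves through
  \<open>gt\<close> and, unless \<open>t2\<close> is a leaf, through \<open>lt\<close>, by linearity
  on the left.\<close>

lemma eval_node_left:
  assumes e: "e \<in> A" and t2: "valid_edge \<gamma> y t2" "valid_tree \<gamma> t2" and z: "z \<in> {1..\<gamma>}"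
    and p: "Poly_Mapping.keys p \<subseteq> edge_valued_trees \<gamma>"
  shows "linear_extension scale (eval_tree e) (node_left (enat z) y t2 p) =
         (let u = gt z (linear_extension scale (eval_tree e) p) e
          in if t2 = Leaf then u else lt (the_enat y) u (eval_tree e t2))"
proof -
  let ?h = "\<lambda>v. if t2 = Leaf then gt z v e else lt (the_enat y) (gt z v e) (eval_tree e t2)"
  have "linear_extension scale (eval_tree e) (node_left (enat z) y t2 p) =
        linear_extension scale (\<lambda>u. ?h (eval_tree e u)) p"
    unfolding linear_extension_lin_ext
    by (rule linear_extension_cong) (use p in \<open>auto simp: edge_valued_trees_def Let_def\<close>)
  also have "\<dots> = ?h (linear_extension scale (eval_tree e) p)"
  proof (rule linear_extension_image_carrier)
    have t2': "t2 \<noteq> Leaf \<Longrightarrow> the_enat y \<in> {1..\<gamma>}"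
      using t2 by (auto simp: valid_edge_not_Leaf)
    show "?h (u + v) = ?h u + ?h v" if "u \<in> A" "v \<in> A" for u v
      using that z e t2' eval_tree_in_carrier[OF e t2(2)]
      by (simp add: gt_add_left lt_add_left gt_closed)
    show "?h (scale c v) = scale c (?h v)" if "v \<in> A" for c v
      using that z e t2' eval_tree_in_carrier[OF e t2(2)]
      by (simp add: gt_scale_left lt_scale_left gt_closed)
    show "eval_tree e t \<in> A" if "t \<in> Poly_Mapping.keys p" for t
      using that p e by (auto simp: edge_valued_trees_def intro!: eval_tree_in_carrier)
  qed
  finally show ?thesis by (simp add: Let_def)
qed

text \<open>Both operations are treated together because each recursion calls the other. The
  recursive value of \<open>tree_lt\<close> is one side of \<open>lt_lt\<close>, that of
  \<open>tree_gt\<close> one side of \<open>gt_gt\<close>.\<close>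

lemma eval_tree_lt_gt:
  assumes e: "e \<in> A" and "s \<in> edge_valued_trees \<gamma>" "t \<in> edge_valued_trees \<gamma>" "a \<in> {1..\<gamma>}"
  shows "linear_extension scale (eval_tree e) (tree_lt (enat a) s t) =
           lt a (eval_tree e s) (eval_tree e t) \<and>
         linear_extension scale (eval_tree e) (tree_gt (enat a) s t) =
           gt a (eval_tree e s) (eval_tree e t)"
  using assms(2-)
proof (induction "size s + size t" arbitrary: s t a rule: less_induct)
  case less
  note s = less.prems(1) and t = less.prems(2) and a = less.prems(3)
  let ?E = "linear_extension scale (eval_tree e)"
  have in_A: "eval_tree e u \<in> A" if "valid_tree \<gamma> u" for u
    by (rule eval_tree_in_carrier[OF e that])
  have s': "s \<noteq> Leaf" "valid_tree \<gamma> s" and t': "t \<noteq> Leaf" "valid_tree \<gamma> t"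
    using s t by (auto simp: edge_valued_trees_def)
  obtain x s1 y s2 where sN: "s = Node x s1 y s2" using s' by (cases s) auto
  have s1: "valid_edge \<gamma> x s1" "valid_tree \<gamma> s1" and s2: "valid_edge \<gamma> y s2" "valid_tree \<gamma> s2"
    using s' sN by auto
  let ?w = "eval_tree e (Node x s1 \<infinity> Leaf)"
  have w: "?w \<in> A" using s1 by (intro in_A) simp
  have "?E (tree_lt (enat a) s t) = lt a (eval_tree e s) (eval_tree e t)"
  proof (cases "s2 = Leaf")
    \<comment> \<open>Now \<open>y = \<infinity>\<close>: the \<open>tree_lt\<close> summand
      vanishes, the \<open>tree_gt\<close> summand is \<open>t\<close>, and the new label is
      \<open>a\<close>.\<close>
    case True
    then show ?thesis
      using s2 t t' a eval_node_right[OF e s1 a, of "Poly_Mapping.single t 1"]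
      by (simp add: sN tree_lt_Node)
  next
    case False
    then obtain b where b: "b \<in> {1..\<gamma>}" and y: "y = enat b"
      using s2 by (auto simp: valid_edge_not_Leaf)
    have s2E: "s2 \<in> edge_valued_trees \<gamma>" using False s2 by (simp add: edge_valued_trees_def)
    have "?E (tree_lt (enat a) s2 t + tree_gt y s2 t) =
        lt a (eval_tree e s2) (eval_tree e t) + gt b (eval_tree e s2) (eval_tree e t)"
      using less.hyps[OF _ s2E t a] less.hyps[OF _ s2E t b] by (simp add: sN y linear_extension_add)
    moreover have "Poly_Mapping.keys (tree_lt (enat a) s2 t + tree_gt y s2 t :: etree \<Rightarrow>\<^sub>0 'k)
        \<subseteq> edge_valued_trees \<gamma>"
      using keys_add keys_tree_lt[OF s2(2) t'(2) a] keys_tree_gt[OF s2(2) t'(2) b]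
      unfolding y by fastforce
    moreover have m: "min a b \<in> {1..\<gamma>}" "min (enat a) y = enat (min a b)"
      using a b by (auto simp: y min_def)
    ultimately have "?E (tree_lt (enat a) s t) =
        lt (min a b) ?w (lt a (eval_tree e s2) (eval_tree e t) + gt b (eval_tree e s2) (eval_tree e t))"
      using t' eval_node_right[OF e s1] by (simp add: sN tree_lt_Node del: eval_tree.simps)
    also have "\<dots> = lt a (lt b ?w (eval_tree e s2)) (eval_tree e t)"
      using lt_lt[OF a b w in_A[OF s2(2)] in_A[OF t'(2)]]
        lt_add_right[OF m(1) w lt_closed[OF a in_A[OF s2(2)] in_A[OF t'(2)]]
          gt_closed[OF b in_A[OF s2(2)] in_A[OF t'(2)]]]
      by (simp del: eval_tree.simps)
    also have "lt b ?w (eval_tree e s2) = eval_tree e s"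
      using False by (simp add: sN y Let_def)
    finally show ?thesis .
  qed
  moreover
  obtain x t1 y t2 where tN: "t = Node x t1 y t2" using t' by (cases t) auto
  have t1: "valid_edge \<gamma> x t1" "valid_tree \<gamma> t1" and t2: "valid_edge \<gamma> y t2" "valid_tree \<gamma> t2"
    using t' tN by auto
  \<comment> \<open>\<open>?v\<close> is the value of \<open>t\<close> without its right subtree,
    and \<open>?r\<close> reattaches that subtree.\<close>
  let ?r = "\<lambda>u. if t2 = Leaf then u else lt (the_enat y) u (eval_tree e t2)"
  let ?v = "if t1 = Leaf then e else gt (the_enat x) (eval_tree e t1) e"
  have v: "?v \<in> A"
    using t1 e in_A by (auto simp: valid_edge_not_Leaf intro!: gt_closed)
  \<comment> \<open>By \<open>gt_lt\<close>, reattaching the right subtree commutes with multiplying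
    by the value of \<open>s\<close> from the left.\<close>
  have r: "?r (gt a (eval_tree e s) ?v) = gt a (eval_tree e s) (eval_tree e t)"
    using t2 a v in_A s' by (auto simp: tN Let_def valid_edge_not_Leaf gt_lt)
  have "?E (tree_gt (enat a) s t) = gt a (eval_tree e s) (eval_tree e t)"
  proof (cases "t1 = Leaf")
    case True
    then show ?thesis
      using t1 s s' a eval_node_left[OF e t2 a, of "Poly_Mapping.single s 1"] r
      by (simp add: tN tree_gt_Node Let_def split: if_splits)
  next
    case False
    then obtain b where b: "b \<in> {1..\<gamma>}" and x: "x = enat b"
      using t1 by (auto simp: valid_edge_not_Leaf)
    have t1E: "t1 \<in> edge_valued_trees \<gamma>" using False t1 by (simp add: edge_valued_trees_def)
    have "?E (tree_gt (enat a) s t1 + tree_lt x s t1) =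
        gt a (eval_tree e s) (eval_tree e t1) + lt b (eval_tree e s) (eval_tree e t1)"
      using less.hyps[OF _ s t1E a] less.hyps[OF _ s t1E b] by (simp add: tN x linear_extension_add)
    moreover have "Poly_Mapping.keys (tree_gt (enat a) s t1 + tree_lt x s t1 :: etree \<Rightarrow>\<^sub>0 'k)
        \<subseteq> edge_valued_trees \<gamma>"
      using keys_add keys_tree_lt[OF s'(2) t1(2) b] keys_tree_gt[OF s'(2) t1(2) a]
      unfolding x by fastforce
    moreover have m: "min a b \<in> {1..\<gamma>}" "min (enat a) x = enat (min a b)"
      using a b by (auto simp: x min_def)
    ultimately have "?E (tree_gt (enat a) s t) =
        ?r (gt (min a b) (gt a (eval_tree e s) (eval_tree e t1)
          + lt b (eval_tree e s) (eval_tree e t1)) e)"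
      using s' eval_node_left[OF e t2] by (simp add: tN tree_gt_Node Let_def del: eval_tree.simps)
    \<comment> \<open>This is \<open>gt_gt\<close> with the generator image \<open>e\<close> as
      third argument.\<close>
    also have "gt (min a b) (gt a (eval_tree e s) (eval_tree e t1)
          + lt b (eval_tree e s) (eval_tree e t1)) e
        = gt a (eval_tree e s) ?v"
      using gt_gt[OF a b in_A[OF s'(2)] in_A[OF t1(2)] e] False
        gt_add_left[OF m(1) gt_closed[OF a in_A[OF s'(2)] in_A[OF t1(2)]]
          lt_closed[OF b in_A[OF s'(2)] in_A[OF t1(2)]] e]
      by (simp add: x add.commute)
    finally show ?thesis using r by simp
  qed
  ultimately show ?case ..
qed

lemma eval_tree_hom:
  assumes e: "e \<in> A"
  shows "polydendriform_hom \<gamma> fscale (tree_space \<gamma>) space_lt space_gt scale A lt gt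
           (restrict (linear_extension scale (eval_tree e)) (tree_space \<gamma>))"
proof -
  \<comment> \<open>Closure of \<open>tree_space\<close> keeps sums, multiples and products where
    the restriction agrees with the linear extension.\<close>
  interpret T: polydendriform_algebra fscale \<gamma> "tree_space \<gamma> :: (etree \<Rightarrow>\<^sub>0 'k) set" space_lt space_gt
    by (rule tree_space_polydendriform)
  have in_A: "eval_tree e t \<in> A" if "t \<in> Poly_Mapping.keys p" "p \<in> tree_space \<gamma>"
    for t and p :: "etree \<Rightarrow>\<^sub>0 'k"
    using that by (intro eval_tree_in_carrier[OF e])
      (auto simp: tree_space_def edge_valued_trees_def)
  have lt: "linear_extension scale (eval_tree e) (space_lt a p q) =
      lt a (linear_extension scale (eval_tree e) p) (linear_extension scale (eval_tree e) q)"
    if "a \<in> {1..\<gamma>}" "p \<in> tree_space \<gamma>" "q \<in> tree_space \<gamma>" for a p q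
    unfolding space_lt_def
    by (rule linear_extension_bilinear)
       (use that in \<open>auto simp: lt_closed lt_add_left lt_add_right lt_scale_left lt_scale_right tree_space_def
         intro!: in_A eval_tree_lt_gt[OF e, THEN conjunct1]\<close>)
  have gt: "linear_extension scale (eval_tree e) (space_gt a p q) =
      gt a (linear_extension scale (eval_tree e) p) (linear_extension scale (eval_tree e) q)"
    if "a \<in> {1..\<gamma>}" "p \<in> tree_space \<gamma>" "q \<in> tree_space \<gamma>" for a p q
    unfolding space_gt_def
    by (rule linear_extension_bilinear)
       (use that in \<open>auto simp: gt_closed gt_add_left gt_add_right gt_scale_left gt_scale_right tree_space_def
         intro!: in_A eval_tree_lt_gt[OF e, THEN conjunct2]\<close>)
  show ?thesis
    unfolding polydendriform_hom_def
    using linear_extension_eval_tree_in_carrier[OF e] T.subspace_carrier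
    by (simp add: lt gt T.lt_closed T.gt_closed fscale.subspace_add fscale.subspace_scale
        linear_extension_add linear_extension_fscale)
qed

lemma hom_eq_eval_tree:
  assumes hom: "polydendriform_hom \<gamma> fscale (tree_space \<gamma>) space_lt space_gt scale A lt gt \<phi>"
    and p: "p \<in> tree_space \<gamma>"
  shows "\<phi> p = linear_extension scale (eval_tree (\<phi> (Poly_Mapping.single one_node_tree 1))) p"
proof -
  let ?e = "\<phi> (Poly_Mapping.single one_node_tree 1)"
  interpret vector_space_pair fscale scale ..
  have one: "one_node_tree \<in> edge_valued_trees \<gamma>"
    by (simp add: one_node_tree_def edge_valued_trees_def)
  have lt: "\<phi> (tree_lt (enat a) s t) = lt a (\<phi> (Poly_Mapping.single s 1)) (\<phi> (Poly_Mapping.single t 1))"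
    if "a \<in> {1..\<gamma>}" "s \<in> edge_valued_trees \<gamma>" "t \<in> edge_valued_trees \<gamma>" for a s t
    using hom that single_in_tree_space unfolding polydendriform_hom_def space_lt_def
    by (metis bilin_ext_single)
  have gt: "\<phi> (tree_gt (enat a) s t) = gt a (\<phi> (Poly_Mapping.single s 1)) (\<phi> (Poly_Mapping.single t 1))"
    if "a \<in> {1..\<gamma>}" "s \<in> edge_valued_trees \<gamma>" "t \<in> edge_valued_trees \<gamma>" for a s t
    using hom that single_in_tree_space unfolding polydendriform_hom_def space_gt_def
    by (metis bilin_ext_single)
  have tree: "\<phi> (Poly_Mapping.single t 1) = eval_tree ?e t" if "t \<in> edge_valued_trees \<gamma>" for t
    using that
  proof (induction t)
    case (Node x t1 y t2)
    then have t1: "valid_edge \<gamma> x t1" "valid_tree \<gamma> t1" and t2: "valid_edge \<gamma> y t2" "valid_tree \<gamma> t2"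
      by (auto simp: edge_valued_trees_def)
    \<comment> \<open>The tree without its right subtree comes first, since it is the left factor of
      the \<open>lt\<close> product giving the whole tree.\<close>
    have left: "\<phi> (Poly_Mapping.single (Node x t1 \<infinity> Leaf) 1) = eval_tree ?e (Node x t1 \<infinity> Leaf)"
    proof (cases "t1 = Leaf")
      case True
      then show ?thesis using t1 by (simp add: one_node_tree_def)
    next
      case False
      then obtain b where "b \<in> {1..\<gamma>}" "x = enat b"
        using t1 by (auto simp: valid_edge_not_Leaf)
      then show ?thesis
        using gt[of b t1 one_node_tree] False t1 one Node.IH(1)
        by (simp add: single_Node_left edge_valued_trees_def)
    qed
    show ?case
    proof (cases "t2 = Leaf")
      case True
      then show ?thesis using left t2 by simp
    next
      case False
      then obtain b where "b \<in> {1..\<gamma>}" "y = enat b"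
        using t2 by (auto simp: valid_edge_not_Leaf)
      then show ?thesis
        using lt[of b "Node x t1 \<infinity> Leaf" t2] False t1 t2 left Node.IH(2)
        by (simp add: single_Node_right edge_valued_trees_def Let_def)
    qed
  qed (simp add: edge_valued_trees_def)
  \<comment> \<open>\<open>p\<close> is written as the combination of its basis trees, so that
    linearity of \<phi> on \<open>tree_space\<close> reduces the claim to
    \<open>tree\<close>.\<close>
  have "\<phi> (lin_ext (\<lambda>t. Poly_Mapping.single t 1) p) =
        linear_extension scale (\<lambda>t. \<phi> (Poly_Mapping.single t 1)) p"
    unfolding lin_ext_eq_linear_extension
    by (rule linear_extension_image[of "tree_space \<gamma>"])
       (use hom p in \<open>auto simp: polydendriform_hom_def tree_space_def subspace_keys_subset\<close>)
  also have "\<dots> = linear_extension scale (eval_tree ?e) p"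
    using p by (intro linear_extension_cong tree) (auto simp: tree_space_def)
  finally show ?thesis by simp
qed

end

theorem theorem2p2p3:
  fixes \<gamma> :: nat
  shows "polydendriform_algebra
           (fscale :: 'k::field_char_0 \<Rightarrow> (etree \<Rightarrow>\<^sub>0 'k) \<Rightarrow> (etree \<Rightarrow>\<^sub>0 'k))
           \<gamma> (tree_space \<gamma>) space_lt space_gt \<and>
         (\<forall>(scaleA :: 'k \<Rightarrow> 'a::ab_group_add \<Rightarrow> 'a) A ltA gtA.
           polydendriform_algebra scaleA \<gamma> A ltA gtA \<longrightarrow>
           (\<forall>e\<in>A. \<exists>!\<phi> :: (etree \<Rightarrow>\<^sub>0 'k) \<Rightarrow> 'a.
              \<phi> \<in> extensional (tree_space \<gamma>) \<and>
              polydendriform_hom \<gamma> fscale (tree_space \<gamma>) space_lt space_gt scaleA A ltA gtA \<phi> \<and>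
              \<phi> (Poly_Mapping.single one_node_tree 1) = e))"
proof (intro conjI allI impI ballI)
  fix scaleA :: "'k \<Rightarrow> 'a \<Rightarrow> 'a" and A ltA gtA e
  assume "polydendriform_algebra scaleA \<gamma> A ltA gtA" and e: "e \<in> A"
  then interpret A: polydendriform_algebra scaleA \<gamma> A ltA gtA by simp
  \<comment> \<open>A morphism is determined on \<open>tree_space\<close> only; restriction picks
    its extensional representative, the one for which uniqueness is claimed.\<close>
  let ?E = "restrict (linear_extension scaleA (A.eval_tree e)) (tree_space \<gamma>)"
  have one: "(Poly_Mapping.single one_node_tree 1 :: etree \<Rightarrow>\<^sub>0 'k) \<in> tree_space \<gamma>"
    by (rule single_in_tree_space) (simp add: one_node_tree_def edge_valued_trees_def)
  show "\<exists>!\<phi> :: (etree \<Rightarrow>\<^sub>0 'k) \<Rightarrow> 'a.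
          \<phi> \<in> extensional (tree_space \<gamma>) \<and>
          polydendriform_hom \<gamma> fscale (tree_space \<gamma>) space_lt space_gt scaleA A ltA gtA \<phi> \<and>
          \<phi> (Poly_Mapping.single one_node_tree 1) = e"
  proof (rule ex1I[of _ ?E])
    show "?E \<in> extensional (tree_space \<gamma>) \<and>
          polydendriform_hom \<gamma> fscale (tree_space \<gamma>) space_lt space_gt scaleA A ltA gtA ?E \<and>
          ?E (Poly_Mapping.single one_node_tree 1) = e"
      using A.eval_tree_hom[OF e] one by (simp add: A.eval_tree_one_node)
  next
    fix \<phi> :: "(etree \<Rightarrow>\<^sub>0 'k) \<Rightarrow> 'a"
    assume \<phi>: "\<phi> \<in> extensional (tree_space \<gamma>) \<and>
          polydendriform_hom \<gamma> fscale (tree_space \<gamma>) space_lt space_gt scaleA A ltA gtA \<phi> \<and>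
          \<phi> (Poly_Mapping.single one_node_tree 1) = e"
    then show "\<phi> = ?E"
      using A.hom_eq_eval_tree[of \<phi>]
      by (intro extensionalityI[of _ "tree_space \<gamma>"]) auto
  qed
qed (rule tree_space_polydendriform)

end
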